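(* Let $(Q,\cdot)$ be a loop with a self-map $\sigma:Q\to Q$, let $A(Q)$ be a group of automorphisms of $(Q,\cdot)$, and let $(H,\circ)$ be the $A$-holomorph of $(Q,\cdot)$, equipped with the self-map $\sigma':H\to H$, $\sigma'(\alpha,x)=(\alpha,\sigma(x))$ for all $(\alpha,x)\in H$. Then $(H,\circ)$ is a $\sigma'$-generalised Bol loop if and only if $$\Big(R_{x}^{-1},\; L_xR_{[\sigma(x\gamma^{-1})]\alpha^{-1}},\; R_{[\sigma(x\gamma^{-1})]\alpha^{-1}}\Big)\in AUT(Q,\cdot)$$ for all $x\in Q$ and all $\alpha,\gamma\in A(Q)$.
   Context: Juxtaposition binds more tightly than $\cdot$, so $xy\cdot z=(x\cdot y)\cdot z$. Translations and automorphisms are written on the right of their arguments and composed left to right: $x(\alpha\beta)=(x\alpha)\beta$; $yL_x=x\cdot y$ and $yR_x=y\cdot x$. A self-map $\sigma$ is an arbitrary function, written on the left. A loop is a quasigroup with two-sided identity $e$. A loop $(L,\cdot)$ with self-map $\sigma$ is a $\sigma$-generalised (right) Bol loop if $(xy\cdot z)\sigma(y)=x(yz\cdot\sigma(y))$ for all $x,y,z\in L$. A triple $(A,B,C)$ of bijections of $Q$ is an autotopism of $(Q,\cdot)$, written $(A,B,C)\in AUT(Q,\cdot)$, if $xA\cdot yB=(x\cdot y)C$ for all $x,y\in Q$. $A$-holomorph: for a subgroup $A(Q)$ of the automorphism group $AUM(Q,\cdot)$, put $H=A(Q)\times Q$ with $(\alpha,x)\circ(\beta,y)=(\alpha\beta,\,x\beta\cdot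 y)$. Then $(H,\circ)$ is a loop, called the $A$-holomorph of $(Q,\cdot)$. *)

theory Defs
  imports "HOL-Algebra.Bij"
begin

text \<open>
  Loops live on the carrier of a HOL-Algebra \<open>monoid\<close> record, whose field \<open>one\<close>
  is the identity \<open>e\<close>; associativity is of course not assumed.

  Mappings of a loop \<open>Q\<close> (automorphisms, translations) are elements of \<open>Bij (carrier Q)\<close>,
  i.e. bijections of the carrier that are \<open>undefined\<close> outside it. Informally they act on the
  right and are composed left to right, so \<open>x\<alpha>\<close> is \<open>\<alpha> x\<close> and the composite \<open>\<alpha>\<beta>\<close>
  (first \<open>\<alpha>\<close>, then \<open>\<beta>\<close>) is \<open>compose (carrier Q) \<beta> \<alpha>\<close>.
\<close>

locale quasigroup =
  fixes Q (structure)
  assumes m_closed [simp, intro]: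
      "\<lbrakk>x \<in> carrier Q; y \<in> carrier Q\<rbrakk> \<Longrightarrow> x \<otimes> y \<in> carrier Q"
    and left_div: "\<lbrakk>a \<in> carrier Q; b \<in> carrier Q\<rbrakk> \<Longrightarrow> \<exists>!x. x \<in> carrier Q \<and> a \<otimes> x = b"
    and right_div: "\<lbrakk>a \<in> carrier Q; b \<in> carrier Q\<rbrakk> \<Longrightarrow> \<exists>!y. y \<in> carrier Q \<and> y \<otimes> a = b"

locale loop = quasigroup +
  assumes one_closed [simp, intro]: "\<one> \<in> carrier Q"
    and l_one [simp]: "x \<in> carrier Q \<Longrightarrow> \<one> \<otimes> x = x"
    and r_one [simp]: "x \<in> carrier Q \<Longrightarrow> x \<otimes> \<one> = x"

locale gen_bol_loop = loop +
  fixes \<sigma>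
  assumes self_map: "\<sigma> \<in> carrier Q \<rightarrow> carrier Q"
    and gen_bol: "\<lbrakk>x \<in> carrier Q; y \<in> carrier Q; z \<in> carrier Q\<rbrakk>
      \<Longrightarrow> ((x \<otimes> y) \<otimes> z) \<otimes> \<sigma> y = x \<otimes> ((y \<otimes> z) \<otimes> \<sigma> y)"

definition ltrans :: "('a, 'b) monoid_scheme \<Rightarrow> 'a \<Rightarrow> 'a \<Rightarrow> 'a"
  where "ltrans Q x = (\<lambda>y\<in>carrier Q. x \<otimes>\<^bsub>Q\<^esub> y)"

definition rtrans :: "('a, 'b) monoid_scheme \<Rightarrow> 'a \<Rightarrow> 'a \<Rightarrow> 'a"
  where "rtrans Q x = (\<lambda>y\<in>carrier Q. y \<otimes>\<^bsub>Q\<^esub> x)"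

definition autotopisms ::
    "('a, 'b) monoid_scheme \<Rightarrow> (('a \<Rightarrow> 'a) \<times> ('a \<Rightarrow> 'a) \<times> ('a \<Rightarrow> 'a)) set"
  where "autotopisms Q =
    {(A, B, C). A \<in> Bij (carrier Q) \<and> B \<in> Bij (carrier Q) \<and> C \<in> Bij (carrier Q) \<and>
       (\<forall>x\<in>carrier Q. \<forall>y\<in>carrier Q. A x \<otimes>\<^bsub>Q\<^esub> B y = C (x \<otimes>\<^bsub>Q\<^esub> y))}"

definition holomorph ::
    "('a, 'b) monoid_scheme \<Rightarrow> ('a \<Rightarrow> 'a) set \<Rightarrow> (('a \<Rightarrow> 'a) \<times> 'a) monoid"
  where "holomorph Q A =
    \<lparr>carrier = A \<times> carrier Q,
     mult = (\<lambda>(\<alpha>, x) (\<beta>, y). (compose (carrier Q) \<beta> \<alpha>, \<beta> x \<otimes>\<^bsub>Q\<^esub> y)),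
     one = (\<one>\<^bsub>AutoGroup Q\<^esub>, \<one>\<^bsub>Q\<^esub>)\<rparr>"

end

theory Submission
  imports Defs
begin

text \<open>
  Write the translations and automorphisms on the right. Multiplying out both sides of the
  generalised Bol law for \<open>(\<alpha>, x)\<close>, \<open>(\<beta>, y)\<close>, \<open>(\<gamma>, z)\<close> in the holomorph gives \<open>\<alpha>\<beta>\<gamma>\<beta>\<close> as
  the first coordinate on either side, so the law only says that the second coordinates agree:
  \<open>((x\<beta>\<cdot>y)\<gamma>\<cdot>z)\<beta> \<cdot> \<sigma>(y) = x\<beta>\<gamma>\<beta> \<cdot> ((y\<gamma>\<cdot>z)\<beta> \<cdot> \<sigma>(y))\<close>.
  The automorphism \<open>\<beta>\<inverse>\<close> can be applied to both sides. With \<open>X = x\<beta>\<gamma>\<close> and \<open>Y = y\<gamma>\<close>, which range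
  independently over the whole loop, this turns the identity into
  \<open>(XY\<cdot>z) s = X (Yz\<cdot>s)\<close> where \<open>s = [\<sigma>(Y\<gamma>\<inverse>)]\<beta>\<inverse>\<close>
  (lemma \<open>twisted_bol_iff\<close>): a Bol identity in the original loop whose last factor is twisted by
  two automorphisms. Substituting \<open>u = XY\<close>, that is, \<open>X = uR\<^sub>Y\<inverse>\<close>, makes it
  \<open>uR\<^sub>Y\<inverse> \<cdot> zL\<^sub>YR\<^sub>s = (uz)R\<^sub>s\<close>, which is the autotopism condition (lemma \<open>bol_autotopism_iff\<close>).
  The automorphism called \<open>\<alpha>\<close> in the theorem is therefore the \<open>\<beta>\<close> of this computation.
\<close>

section \<open>Translations and autotopisms of loops\<close>

context quasigroup
begin

lemma l_cancel:
  assumes "a \<in> carrier Q" "x \<in> carrier Q" "y \<in> carrier Q"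
  shows "a \<otimes> x = a \<otimes> y \<longleftrightarrow> x = y"
  using left_div[OF assms(1) m_closed[OF assms(1,2)]] assms(2,3) by metis

lemma r_cancel:
  assumes "a \<in> carrier Q" "x \<in> carrier Q" "y \<in> carrier Q"
  shows "x \<otimes> a = y \<otimes> a \<longleftrightarrow> x = y"
  using right_div[OF assms(1) m_closed[OF assms(2,1)]] assms(2,3) by metis

lemma ltrans_Bij:
  assumes x: "x \<in> carrier Q"
  shows "ltrans Q x \<in> Bij (carrier Q)"
proof -
  have "bij_betw (\<lambda>y. x \<otimes> y) (carrier Q) (carrier Q)"
    unfolding bij_betw_def
  proof
    show "inj_on (\<lambda>y. x \<otimes> y) (carrier Q)"
      using x by (simp add: inj_on_def l_cancel)
    show "(\<lambda>y. x \<otimes> y) ` carrier Q = carrier Q"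
      using x left_div[OF x] by blast
  qed
  then show ?thesis
    by (simp add: ltrans_def Bij_def)
qed

lemma rtrans_Bij:
  assumes x: "x \<in> carrier Q"
  shows "rtrans Q x \<in> Bij (carrier Q)"
proof -
  have "bij_betw (\<lambda>y. y \<otimes> x) (carrier Q) (carrier Q)"
    unfolding bij_betw_def
  proof
    show "inj_on (\<lambda>y. y \<otimes> x) (carrier Q)"
      using x by (simp add: inj_on_def r_cancel)
    show "(\<lambda>y. y \<otimes> x) ` carrier Q = carrier Q"
      using x right_div[OF x] by blast
  qed
  then show ?thesis
    by (simp add: rtrans_def Bij_def)
qed

lemma inv_rtrans_Bij:
  assumes "x \<in> carrier Q"
  shows "inv\<^bsub>BijGroup (carrier Q)\<^esub> (rtrans Q x) \<in> Bij (carrier Q)"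
  by (simp only: inv_BijGroup[OF rtrans_Bij[OF assms]] restrict_inv_into_Bij[OF rtrans_Bij[OF assms]])

lemma inv_rtrans_mult:
  assumes x: "x \<in> carrier Q" and u: "u \<in> carrier Q"
  shows "(inv\<^bsub>BijGroup (carrier Q)\<^esub> (rtrans Q x)) (u \<otimes> x) = u"
proof -
  have "rtrans Q x u = u \<otimes> x"
    using u by (simp add: rtrans_def)
  moreover have "inv_into (carrier Q) (rtrans Q x) (rtrans Q x u) = u"
    using rtrans_Bij[OF x] u by (simp add: Bij_def bij_betw_def)
  ultimately show ?thesis
    using x u by (simp add: inv_BijGroup[OF rtrans_Bij[OF x]])
qed

text \<open>
  The second and third components both end with \<open>R\<^sub>s\<close>, so this is the generalised Bol identity at
  a single middle factor \<open>x\<close>, with an arbitrary element \<open>s\<close> in place of \<open>\<sigma>(x)\<close>. Every first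
  argument of the autotopism has the form \<open>ux\<close>, which removes the inverse of \<open>R\<^sub>x\<close>.
\<close>

lemma bol_autotopism_iff:
  assumes x: "x \<in> carrier Q" and s: "s \<in> carrier Q"
  shows "(inv\<^bsub>BijGroup (carrier Q)\<^esub> (rtrans Q x),
          compose (carrier Q) (rtrans Q s) (ltrans Q x),
          rtrans Q s) \<in> autotopisms Q \<longleftrightarrow>
    (\<forall>u\<in>carrier Q. \<forall>z\<in>carrier Q.
      ((u \<otimes> x) \<otimes> z) \<otimes> s = u \<otimes> ((x \<otimes> z) \<otimes> s))"
    (is "(?J, ?B, ?R) \<in> _ \<longleftrightarrow> ?bol")
proof -
  have B: "?B z = (x \<otimes> z) \<otimes> s" if "z \<in> carrier Q" for z
    using that x by (simp add: compose_eq ltrans_def rtrans_def)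
  have R: "?R v = v \<otimes> s" if "v \<in> carrier Q" for v
    using that by (simp add: rtrans_def)
  have "(?J, ?B, ?R) \<in> autotopisms Q \<longleftrightarrow>
      (\<forall>w\<in>carrier Q. \<forall>z\<in>carrier Q. ?J w \<otimes> ?B z = ?R (w \<otimes> z))"
    using x s by (simp add: autotopisms_def inv_rtrans_Bij rtrans_Bij ltrans_Bij compose_Bij)
  also have "\<dots> \<longleftrightarrow> ?bol"
  proof
    assume aut: "\<forall>w\<in>carrier Q. \<forall>z\<in>carrier Q. ?J w \<otimes> ?B z = ?R (w \<otimes> z)"
    show ?bol
    proof (intro ballI)
      fix u z assume uz: "u \<in> carrier Q" "z \<in> carrier Q"
      from aut uz x have "?J (u \<otimes> x) \<otimes> ?B z = ?R ((u \<otimes> x) \<otimes> z)" by blast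
      then show "((u \<otimes> x) \<otimes> z) \<otimes> s = u \<otimes> ((x \<otimes> z) \<otimes> s)"
        using uz x by (simp add: inv_rtrans_mult B R)
    qed
  next
    assume bol: ?bol
    show "\<forall>w\<in>carrier Q. \<forall>z\<in>carrier Q. ?J w \<otimes> ?B z = ?R (w \<otimes> z)"
    proof (intro ballI)
      fix w z assume wz: "w \<in> carrier Q" "z \<in> carrier Q"
      then obtain u where u: "u \<in> carrier Q" and w: "w = u \<otimes> x"
        using right_div[of x w] x by blast
      show "?J w \<otimes> ?B z = ?R (w \<otimes> z)"
        using bol u wz x by (simp add: w inv_rtrans_mult B R)
    qed
  qed
  finally show ?thesis .
qed

end

section \<open>Groups of automorphisms\<close>

lemma (in loop) subgroup_auto: "subgroup (auto Q) (BijGroup (carrier Q))"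
proof (rule subgroup.intro)
  show "auto Q \<subseteq> carrier (BijGroup (carrier Q))"
    by (auto simp: auto_def BijGroup_def)
next
  fix f g assume "f \<in> auto Q" "g \<in> auto Q"
  then show "f \<otimes>\<^bsub>BijGroup (carrier Q)\<^esub> g \<in> auto Q"
    by (auto simp: BijGroup_def auto_def compose_Bij compose_eq hom_def Pi_def)
next
  show "\<one>\<^bsub>BijGroup (carrier Q)\<^esub> \<in> auto Q"
    by (simp add: BijGroup_def auto_def hom_def id_Bij)
next
  fix f assume f: "f \<in> auto Q"
  then have B: "f \<in> Bij (carrier Q)" and h: "f \<in> hom Q Q"
    by (auto simp: auto_def)
  have "inv_into (carrier Q) f (x \<otimes> y) = inv_into (carrier Q) f x \<otimes> inv_into (carrier Q) f y"
    if "x \<in> carrier Q" "y \<in> carrier Q" for x y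
    using Bij_inv_into_lemma[where g = "mult Q", OF _ B _ that] h by (auto simp: hom_def)
  then have "restrict (inv_into (carrier Q) f) (carrier Q) \<in> hom Q Q"
    using B by (auto simp: hom_def Bij_inv_into_mem)
  then show "inv\<^bsub>BijGroup (carrier Q)\<^esub> f \<in> auto Q"
    by (simp only: inv_BijGroup[OF B] auto_def Int_iff restrict_inv_into_Bij[OF B] simp_thms)
qed

lemma (in loop) group_AutoGroup: "group (AutoGroup Q)"
  by (simp add: AutoGroup_def subgroup.subgroup_is_group subgroup_auto group_BijGroup)

locale loop_automorphisms = loop +
  fixes A
  assumes subgroup_A: "subgroup A (AutoGroup Q)"
begin

abbreviation aut_inv :: "('a \<Rightarrow> 'a) \<Rightarrow> 'a \<Rightarrow> 'a"
  where "aut_inv \<alpha> \<equiv> inv\<^bsub>AutoGroup Q\<^esub> \<alpha>"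

lemma A_auto: "\<alpha> \<in> A \<Longrightarrow> \<alpha> \<in> auto Q"
  using subgroup.subset[OF subgroup_A] by (auto simp: AutoGroup_def)

lemma A_Bij: "\<alpha> \<in> A \<Longrightarrow> \<alpha> \<in> Bij (carrier Q)"
  using A_auto by (auto simp: auto_def)

lemma A_closed [simp]: "\<lbrakk>\<alpha> \<in> A; x \<in> carrier Q\<rbrakk> \<Longrightarrow> \<alpha> x \<in> carrier Q"
  using A_Bij Bij_imp_funcset by blast

lemma A_funcset: "\<alpha> \<in> A \<Longrightarrow> \<alpha> \<in> carrier Q \<rightarrow> carrier Q"
  by auto

lemma A_mult [simp]:
  "\<lbrakk>\<alpha> \<in> A; x \<in> carrier Q; y \<in> carrier Q\<rbrakk> \<Longrightarrow> \<alpha> (x \<otimes> y) = \<alpha> x \<otimes> \<alpha> y"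
  using A_auto by (auto simp: auto_def hom_def)

lemma A_one [simp]:
  assumes "\<alpha> \<in> A"
  shows "\<alpha> \<one> = \<one>"
proof -
  have "\<alpha> \<one> \<otimes> \<alpha> \<one> = \<alpha> \<one> \<otimes> \<one>"
    using A_mult[OF assms one_closed one_closed] assms by simp
  then show ?thesis
    using assms by (simp only: l_cancel A_closed one_closed)
qed

lemma A_inject [simp]:
  "\<lbrakk>\<alpha> \<in> A; x \<in> carrier Q; y \<in> carrier Q\<rbrakk> \<Longrightarrow> \<alpha> x = \<alpha> y \<longleftrightarrow> x = y"
  using A_Bij by (auto simp: Bij_def bij_betw_def inj_on_def)

lemma A_eqI:
  "\<lbrakk>\<alpha> \<in> A; \<beta> \<in> A; \<And>x. x \<in> carrier Q \<Longrightarrow> \<alpha> x = \<beta> x\<rbrakk> \<Longrightarrow> \<alpha> = \<beta>"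
  by (meson A_Bij Bij_imp_extensional extensionalityI)

lemma AutoGroup_mult:
  "\<lbrakk>\<alpha> \<in> A; \<beta> \<in> A\<rbrakk> \<Longrightarrow> \<beta> \<otimes>\<^bsub>AutoGroup Q\<^esub> \<alpha> = compose (carrier Q) \<beta> \<alpha>"
  by (simp add: AutoGroup_def BijGroup_def A_Bij)

lemma AutoGroup_one: "\<one>\<^bsub>AutoGroup Q\<^esub> = (\<lambda>x\<in>carrier Q. x)"
  by (simp add: AutoGroup_def BijGroup_def)

lemma compose_in_A [simp, intro]:
  "\<lbrakk>\<alpha> \<in> A; \<beta> \<in> A\<rbrakk> \<Longrightarrow> compose (carrier Q) \<beta> \<alpha> \<in> A"
  using subgroup.m_closed[OF subgroup_A, of \<beta> \<alpha>] by (simp add: AutoGroup_mult)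

lemma one_in_A [simp, intro]: "\<one>\<^bsub>AutoGroup Q\<^esub> \<in> A"
  using subgroup.one_closed[OF subgroup_A] .

lemma aut_inv_in_A [simp, intro]: "\<alpha> \<in> A \<Longrightarrow> aut_inv \<alpha> \<in> A"
  using subgroup.m_inv_closed[OF subgroup_A] .

lemma aut_inv_left [simp]:
  assumes "\<alpha> \<in> A" "x \<in> carrier Q"
  shows "aut_inv \<alpha> (\<alpha> x) = x"
proof -
  have "compose (carrier Q) (aut_inv \<alpha>) \<alpha> = (\<lambda>x\<in>carrier Q. x)"
    using group.l_inv[OF group_AutoGroup] subgroup.mem_carrier[OF subgroup_A] assms
    by (metis AutoGroup_mult AutoGroup_one aut_inv_in_A)
  from fun_cong[OF this, of x] show ?thesis
    using assms by (simp add: compose_eq)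
qed

lemma aut_inv_right [simp]:
  assumes "\<alpha> \<in> A" "x \<in> carrier Q"
  shows "\<alpha> (aut_inv \<alpha> x) = x"
proof -
  have "aut_inv \<alpha> (\<alpha> (aut_inv \<alpha> x)) = aut_inv \<alpha> x"
    using assms by simp
  then show ?thesis
    using assms A_inject[of "aut_inv \<alpha>" "\<alpha> (aut_inv \<alpha> x)" x] by simp
qed

section \<open>The holomorph\<close>

abbreviation hol :: "(('a \<Rightarrow> 'a) \<times> 'a) monoid"
  where "hol \<equiv> holomorph Q A"

lemma carrier_hol [simp]: "carrier hol = A \<times> carrier Q"
  by (simp add: holomorph_def)

lemma hol_mult [simp]:
  "(\<alpha>, x) \<otimes>\<^bsub>hol\<^esub> (\<beta>, y) = (compose (carrier Q) \<beta> \<alpha>, \<beta> x \<otimes> y)"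
  by (simp add: holomorph_def)

lemma hol_one [simp]: "\<one>\<^bsub>hol\<^esub> = (\<one>\<^bsub>AutoGroup Q\<^esub>, \<one>)"
  by (simp add: holomorph_def)

lemma compose_left_div:
  assumes "\<alpha> \<in> A" "\<beta> \<in> A" "\<gamma> \<in> A"
  shows "compose (carrier Q) \<beta> \<alpha> = \<gamma> \<longleftrightarrow> \<beta> = compose (carrier Q) \<gamma> (aut_inv \<alpha>)"
proof
  assume "compose (carrier Q) \<beta> \<alpha> = \<gamma>"
  then show "\<beta> = compose (carrier Q) \<gamma> (aut_inv \<alpha>)"
    using assms by (intro A_eqI) (auto simp: compose_eq)
next
  assume "\<beta> = compose (carrier Q) \<gamma> (aut_inv \<alpha>)"
  then show "compose (carrier Q) \<beta> \<alpha> = \<gamma>"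
    using assms by (intro A_eqI) (auto simp: compose_eq)
qed

lemma compose_right_div:
  assumes "\<alpha> \<in> A" "\<beta> \<in> A" "\<gamma> \<in> A"
  shows "compose (carrier Q) \<alpha> \<beta> = \<gamma> \<longleftrightarrow> \<beta> = compose (carrier Q) (aut_inv \<alpha>) \<gamma>"
proof
  assume "compose (carrier Q) \<alpha> \<beta> = \<gamma>"
  then show "\<beta> = compose (carrier Q) (aut_inv \<alpha>) \<gamma>"
    using assms by (intro A_eqI) (auto simp: compose_eq)
next
  assume "\<beta> = compose (carrier Q) (aut_inv \<alpha>) \<gamma>"
  then show "compose (carrier Q) \<alpha> \<beta> = \<gamma>"
    using assms by (intro A_eqI) (auto simp: compose_eq)
qed

text \<open>
  Division is done one coordinate at a time: the automorphism is found first, by division in the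
  group \<open>A\<close>, and once it is known the second coordinate is found by division in the loop. When
  \<open>(\<beta>, y) \<circ> (\<alpha>, x)\<close> is solved for \<open>(\<beta>, y)\<close>, that division yields \<open>y\<alpha>\<close>, and \<open>\<alpha>\<close> must still be
  undone.
\<close>

lemma loop_holomorph: "loop hol"
proof unfold_locales
  fix p q assume "p \<in> carrier hol" "q \<in> carrier hol"
  then show "p \<otimes>\<^bsub>hol\<^esub> q \<in> carrier hol"
    by auto
next
  fix a b assume "a \<in> carrier hol" "b \<in> carrier hol"
  then obtain \<alpha> x \<gamma> z where a: "a = (\<alpha>, x)" "\<alpha> \<in> A" "x \<in> carrier Q"
    and b: "b = (\<gamma>, z)" "\<gamma> \<in> A" "z \<in> carrier Q" by auto
  define \<beta> where "\<beta> = compose (carrier Q) \<gamma> (aut_inv \<alpha>)"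
  have \<beta>: "\<beta> \<in> A" using a b by (simp add: \<beta>_def)
  then obtain y where y: "y \<in> carrier Q" "\<beta> x \<otimes> y = z"
    using left_div[OF A_closed[OF \<beta> a(3)] b(3)] by blast
  show "\<exists>!p. p \<in> carrier hol \<and> a \<otimes>\<^bsub>hol\<^esub> p = b"
  proof (rule ex1I[of _ "(\<beta>, y)"])
    show "(\<beta>, y) \<in> carrier hol \<and> a \<otimes>\<^bsub>hol\<^esub> (\<beta>, y) = b"
      using a b y \<beta> by (simp add: compose_left_div flip: \<beta>_def)
  next
    fix p assume "p \<in> carrier hol \<and> a \<otimes>\<^bsub>hol\<^esub> p = b"
    then obtain \<beta>' y' where p: "p = (\<beta>', y')" "\<beta>' \<in> A" "y' \<in> carrier Q"
      and eq: "compose (carrier Q) \<beta>' \<alpha> = \<gamma>" "\<beta>' x \<otimes> y' = z"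
      using a b by auto
    have "\<beta>' = \<beta>" using eq(1) a b p by (simp add: compose_left_div \<beta>_def)
    moreover from this have "y' = y"
      using eq(2) y p a \<beta> l_cancel[of "\<beta> x" y' y] by simp
    ultimately show "p = (\<beta>, y)" using p by simp
  qed
next
  fix a b assume "a \<in> carrier hol" "b \<in> carrier hol"
  then obtain \<alpha> x \<gamma> z where a: "a = (\<alpha>, x)" "\<alpha> \<in> A" "x \<in> carrier Q"
    and b: "b = (\<gamma>, z)" "\<gamma> \<in> A" "z \<in> carrier Q" by auto
  define \<beta> where "\<beta> = compose (carrier Q) (aut_inv \<alpha>) \<gamma>"
  have \<beta>: "\<beta> \<in> A" using a b by (simp add: \<beta>_def)
  obtain w where w: "w \<in> carrier Q" "w \<otimes> x = z"
    using right_div[OF a(3) b(3)] by blast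
  show "\<exists>!p. p \<in> carrier hol \<and> p \<otimes>\<^bsub>hol\<^esub> a = b"
  proof (rule ex1I[of _ "(\<beta>, aut_inv \<alpha> w)"])
    show "(\<beta>, aut_inv \<alpha> w) \<in> carrier hol \<and> (\<beta>, aut_inv \<alpha> w) \<otimes>\<^bsub>hol\<^esub> a = b"
      using a b w \<beta> by (simp add: compose_right_div flip: \<beta>_def)
  next
    fix p assume "p \<in> carrier hol \<and> p \<otimes>\<^bsub>hol\<^esub> a = b"
    then obtain \<beta>' y' where p: "p = (\<beta>', y')" "\<beta>' \<in> A" "y' \<in> carrier Q"
      and eq: "compose (carrier Q) \<alpha> \<beta>' = \<gamma>" "\<alpha> y' \<otimes> x = z"
      using a b by auto
    have "\<beta>' = \<beta>" using eq(1) a b p by (simp add: compose_right_div \<beta>_def)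
    moreover have "\<alpha> y' = w"
      using eq(2) w p a r_cancel[of x "\<alpha> y'" w] by simp
    then have "y' = aut_inv \<alpha> w" using p a by auto
    ultimately show "p = (\<beta>, aut_inv \<alpha> w)" using p by simp
  qed
next
  show "\<one>\<^bsub>hol\<^esub> \<in> carrier hol" by simp
next
  fix p assume "p \<in> carrier hol"
  then show "\<one>\<^bsub>hol\<^esub> \<otimes>\<^bsub>hol\<^esub> p = p"
    by (auto simp: AutoGroup_one compose_Id[OF A_funcset Bij_imp_extensional[OF A_Bij]])
next
  fix p assume "p \<in> carrier hol"
  then show "p \<otimes>\<^bsub>hol\<^esub> \<one>\<^bsub>hol\<^esub> = p"
    by (auto simp: AutoGroup_one Id_compose[OF A_funcset Bij_imp_extensional[OF A_Bij]])
qed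

section \<open>The Bol law in the holomorph\<close>

text \<open>
  Both sides of the Bol law have first coordinate \<open>\<alpha>\<beta>\<gamma>\<beta>\<close>, and \<open>\<alpha>\<close> does not occur in the second
  coordinates, so it disappears from the condition.
\<close>

lemma gen_bol_holomorph_iff:
  assumes \<sigma>: "\<sigma> \<in> carrier Q \<rightarrow> carrier Q"
  shows "gen_bol_loop hol (\<lambda>(\<alpha>, x). (\<alpha>, \<sigma> x)) \<longleftrightarrow>
    (\<forall>\<beta>\<in>A. \<forall>\<gamma>\<in>A. \<forall>x\<in>carrier Q. \<forall>y\<in>carrier Q. \<forall>z\<in>carrier Q.
      \<beta> (\<gamma> (\<beta> x \<otimes> y) \<otimes> z) \<otimes> \<sigma> y = \<beta> (\<gamma> (\<beta> x)) \<otimes> (\<beta> (\<gamma> y \<otimes> z) \<otimes> \<sigma> y))"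
    (is "gen_bol_loop _ ?\<sigma>' \<longleftrightarrow> ?law")
proof -
  have self: "?\<sigma>' \<in> carrier hol \<rightarrow> carrier hol"
    using \<sigma> by auto
  have coords: "(((\<alpha>, x) \<otimes>\<^bsub>hol\<^esub> (\<beta>, y)) \<otimes>\<^bsub>hol\<^esub> (\<gamma>, z)) \<otimes>\<^bsub>hol\<^esub> ?\<sigma>' (\<beta>, y)
        = (\<alpha>, x) \<otimes>\<^bsub>hol\<^esub> (((\<beta>, y) \<otimes>\<^bsub>hol\<^esub> (\<gamma>, z)) \<otimes>\<^bsub>hol\<^esub> ?\<sigma>' (\<beta>, y)) \<longleftrightarrow>
      \<beta> (\<gamma> (\<beta> x \<otimes> y) \<otimes> z) \<otimes> \<sigma> y = \<beta> (\<gamma> (\<beta> x)) \<otimes> (\<beta> (\<gamma> y \<otimes> z) \<otimes> \<sigma> y)"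
    if "\<alpha> \<in> A" "\<beta> \<in> A" "\<gamma> \<in> A" "x \<in> carrier Q" for \<alpha> \<beta> \<gamma> x y z
  proof -
    have "compose (carrier Q) \<beta> (compose (carrier Q) \<gamma> (compose (carrier Q) \<beta> \<alpha>))
        = compose (carrier Q) (compose (carrier Q) \<beta> (compose (carrier Q) \<gamma> \<beta>)) \<alpha>"
      using that by (intro A_eqI) (auto simp: compose_eq)
    then show ?thesis
      using that by (simp add: compose_eq)
  qed
  show ?thesis
  proof
    assume "gen_bol_loop hol ?\<sigma>'"
    then interpret H: gen_bol_loop hol ?\<sigma>' .
    show ?law
    proof (intro ballI)
      fix \<beta> \<gamma> x y z
      assume *: "\<beta> \<in> A" "\<gamma> \<in> A" "x \<in> carrier Q" "y \<in> carrier Q" "z \<in> carrier Q"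
      show "\<beta> (\<gamma> (\<beta> x \<otimes> y) \<otimes> z) \<otimes> \<sigma> y = \<beta> (\<gamma> (\<beta> x)) \<otimes> (\<beta> (\<gamma> y \<otimes> z) \<otimes> \<sigma> y)"
        by (rule iffD1[OF coords H.gen_bol]) (use * in simp_all)
    qed
  next
    assume law: ?law
    have "gen_bol_loop_axioms hol ?\<sigma>'"
    proof
      show "?\<sigma>' \<in> carrier hol \<rightarrow> carrier hol" by (fact self)
    next
      fix p q r assume "p \<in> carrier hol" "q \<in> carrier hol" "r \<in> carrier hol"
      then obtain \<alpha> x \<beta> y \<gamma> z where pqr: "p = (\<alpha>, x)" "q = (\<beta>, y)" "r = (\<gamma>, z)"
        and *: "\<alpha> \<in> A" "\<beta> \<in> A" "\<gamma> \<in> A" "x \<in> carrier Q" "y \<in> carrier Q" "z \<in> carrier Q"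
        by auto
      show "((p \<otimes>\<^bsub>hol\<^esub> q) \<otimes>\<^bsub>hol\<^esub> r) \<otimes>\<^bsub>hol\<^esub> ?\<sigma>' q = p \<otimes>\<^bsub>hol\<^esub> ((q \<otimes>\<^bsub>hol\<^esub> r) \<otimes>\<^bsub>hol\<^esub> ?\<sigma>' q)"
        unfolding pqr by (rule iffD2[OF coords]) (use law * in blast)+
    qed
    then show "gen_bol_loop hol ?\<sigma>'"
      by (intro gen_bol_loop.intro loop_holomorph)
  qed
qed

text \<open>
  Applying \<open>\<beta>\<inverse>\<close> replaces the last factor \<open>\<sigma>(y)\<close> by \<open>s = [\<sigma>(y)]\<beta>\<inverse>\<close> and leaves \<open>x\<beta>\<gamma>\<close> and
  \<open>y\<gamma>\<close> as the only other traces of the automorphisms. The map \<open>(x, y) \<mapsto> (x\<beta>\<gamma>, y\<gamma>)\<close> is a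
  bijection, so these two elements may be renamed to \<open>u\<close> and \<open>v\<close>.
\<close>

lemma twisted_bol_iff:
  assumes \<sigma>: "\<sigma> \<in> carrier Q \<rightarrow> carrier Q" and \<beta>: "\<beta> \<in> A" and \<gamma>: "\<gamma> \<in> A"
  shows "(\<forall>x\<in>carrier Q. \<forall>y\<in>carrier Q. \<forall>z\<in>carrier Q.
      \<beta> (\<gamma> (\<beta> x \<otimes> y) \<otimes> z) \<otimes> \<sigma> y = \<beta> (\<gamma> (\<beta> x)) \<otimes> (\<beta> (\<gamma> y \<otimes> z) \<otimes> \<sigma> y)) \<longleftrightarrow>
    (\<forall>v\<in>carrier Q. \<forall>u\<in>carrier Q. \<forall>z\<in>carrier Q.
      ((u \<otimes> v) \<otimes> z) \<otimes> aut_inv \<beta> (\<sigma> (aut_inv \<gamma> v))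
        = u \<otimes> ((v \<otimes> z) \<otimes> aut_inv \<beta> (\<sigma> (aut_inv \<gamma> v))))"
    (is "?law \<longleftrightarrow> ?twisted")
proof -
  have key: "\<beta> (\<gamma> (\<beta> x \<otimes> y) \<otimes> z) \<otimes> \<sigma> y = \<beta> (\<gamma> (\<beta> x)) \<otimes> (\<beta> (\<gamma> y \<otimes> z) \<otimes> \<sigma> y) \<longleftrightarrow>
      ((\<gamma> (\<beta> x) \<otimes> \<gamma> y) \<otimes> z) \<otimes> aut_inv \<beta> (\<sigma> y)
        = \<gamma> (\<beta> x) \<otimes> ((\<gamma> y \<otimes> z) \<otimes> aut_inv \<beta> (\<sigma> y))" (is "?L = ?R \<longleftrightarrow> ?l = ?r")
    if xyz: "x \<in> carrier Q" "y \<in> carrier Q" "z \<in> carrier Q" for x y z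
  proof -
    have \<sigma>y: "\<sigma> y \<in> carrier Q" using \<sigma> xyz by auto
    have "?L = \<beta> ?l" "?R = \<beta> ?r"
      using xyz \<sigma>y \<beta> \<gamma> by simp_all
    moreover have "?l \<in> carrier Q" "?r \<in> carrier Q"
      using xyz \<sigma>y \<beta> \<gamma> by auto
    ultimately show ?thesis
      using A_inject[OF \<beta>] by simp
  qed
  show ?thesis
  proof
    assume law: ?law
    show ?twisted
    proof (intro ballI)
      fix v u z assume *: "v \<in> carrier Q" "u \<in> carrier Q" "z \<in> carrier Q"
      let ?x = "aut_inv \<beta> (aut_inv \<gamma> u)" and ?y = "aut_inv \<gamma> v"
      have law': "\<beta> (\<gamma> (\<beta> ?x \<otimes> ?y) \<otimes> z) \<otimes> \<sigma> ?y
          = \<beta> (\<gamma> (\<beta> ?x)) \<otimes> (\<beta> (\<gamma> ?y \<otimes> z) \<otimes> \<sigma> ?y)"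
        by (rule law[rule_format]) (use * \<beta> \<gamma> in simp_all)
      show "((u \<otimes> v) \<otimes> z) \<otimes> aut_inv \<beta> (\<sigma> (aut_inv \<gamma> v))
          = u \<otimes> ((v \<otimes> z) \<otimes> aut_inv \<beta> (\<sigma> (aut_inv \<gamma> v)))"
        using key[of ?x ?y z] law' * \<beta> \<gamma> by simp
    qed
  next
    assume twisted: ?twisted
    show ?law
    proof (intro ballI)
      fix x y z assume *: "x \<in> carrier Q" "y \<in> carrier Q" "z \<in> carrier Q"
      have "((\<gamma> (\<beta> x) \<otimes> \<gamma> y) \<otimes> z) \<otimes> aut_inv \<beta> (\<sigma> (aut_inv \<gamma> (\<gamma> y)))
          = \<gamma> (\<beta> x) \<otimes> ((\<gamma> y \<otimes> z) \<otimes> aut_inv \<beta> (\<sigma> (aut_inv \<gamma> (\<gamma> y))))"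
        by (rule twisted[rule_format]) (use * \<beta> \<gamma> in simp_all)
      then show "\<beta> (\<gamma> (\<beta> x \<otimes> y) \<otimes> z) \<otimes> \<sigma> y = \<beta> (\<gamma> (\<beta> x)) \<otimes> (\<beta> (\<gamma> y \<otimes> z) \<otimes> \<sigma> y)"
        using key[OF *] * \<gamma> by simp
    qed
  qed
qed

end

section \<open>Generalised Bol holomorphs\<close>

theorem theorem3p1:
  fixes Q :: "('a, 'b) monoid_scheme"
    and \<sigma> :: "'a \<Rightarrow> 'a"
    and A :: "('a \<Rightarrow> 'a) set"
  assumes "loop Q"
    and "\<sigma> \<in> carrier Q \<rightarrow> carrier Q"
    and "subgroup A (AutoGroup Q)"
  shows "gen_bol_loop (holomorph Q A) (\<lambda>(\<alpha>, x). (\<alpha>, \<sigma> x)) \<longleftrightarrow>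
    (\<forall>x\<in>carrier Q. \<forall>\<alpha>\<in>A. \<forall>\<gamma>\<in>A.
      let s = (inv\<^bsub>AutoGroup Q\<^esub> \<alpha>) (\<sigma> ((inv\<^bsub>AutoGroup Q\<^esub> \<gamma>) x)) in
        (inv\<^bsub>BijGroup (carrier Q)\<^esub> (rtrans Q x),
         compose (carrier Q) (rtrans Q s) (ltrans Q x),
         rtrans Q s) \<in> autotopisms Q)"
proof -
  interpret loop_automorphisms Q A
    by (rule loop_automorphisms.intro[OF assms(1) loop_automorphisms_axioms.intro[OF assms(3)]])
  let ?s = "\<lambda>\<alpha> \<gamma> x. aut_inv \<alpha> (\<sigma> (aut_inv \<gamma> x))"
  have s: "?s \<alpha> \<gamma> x \<in> carrier Q" if "\<alpha> \<in> A" "\<gamma> \<in> A" "x \<in> carrier Q" for \<alpha> \<gamma> x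
    using that by (simp add: funcset_mem[OF assms(2)])
  have "gen_bol_loop (holomorph Q A) (\<lambda>(\<alpha>, x). (\<alpha>, \<sigma> x)) \<longleftrightarrow>
    (\<forall>\<alpha>\<in>A. \<forall>\<gamma>\<in>A. \<forall>x\<in>carrier Q. \<forall>u\<in>carrier Q. \<forall>z\<in>carrier Q.
      ((u \<otimes>\<^bsub>Q\<^esub> x) \<otimes>\<^bsub>Q\<^esub> z) \<otimes>\<^bsub>Q\<^esub> ?s \<alpha> \<gamma> x
        = u \<otimes>\<^bsub>Q\<^esub> ((x \<otimes>\<^bsub>Q\<^esub> z) \<otimes>\<^bsub>Q\<^esub> ?s \<alpha> \<gamma> x))"
    unfolding gen_bol_holomorph_iff[OF assms(2)]
    by (intro ball_cong refl twisted_bol_iff[OF assms(2)])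
  also have "\<dots> \<longleftrightarrow> (\<forall>\<alpha>\<in>A. \<forall>\<gamma>\<in>A. \<forall>x\<in>carrier Q.
      (inv\<^bsub>BijGroup (carrier Q)\<^esub> (rtrans Q x),
       compose (carrier Q) (rtrans Q (?s \<alpha> \<gamma> x)) (ltrans Q x),
       rtrans Q (?s \<alpha> \<gamma> x)) \<in> autotopisms Q)"
    by (intro ball_cong refl bol_autotopism_iff[symmetric] s)
  finally show ?thesis
    unfolding Let_def by blast
qed

end
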